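(* Let $f:(0,\infty)\to\mathbb{R}$ be continuously differentiable with $f(x)>0$ for all $x>0$, $f'(x)>0$ for all $x>x_1$ (for some $x_1\ge 0$), and $f'(x)\to 0$ as $x\to\infty$. Suppose that the limit $$\lambda:=\lim_{x\to\infty}\frac{f(x)}{x/\log x}\in[0,\infty]$$ exists. Let $\tau>0$, let $\mu$ be a positive finite Borel measure on $[-\tau,0]$, and put $$M:=\int_{[-\tau,0]}\mu(ds)\in(0,\infty),\qquad C:=\int_{[-\tau,0]}|s|\,\mu(ds),$$ with $C>0$. Let $\psi\in C([-\tau,0];(0,\infty))$ and let $x$ be the unique continuous solution of $$x'(t)=\int_{[-\tau,0]}\mu(ds)\,f(x(t+s)),\quad t>0;\qquad x(t)=\psi(t),\quad t\in[-\tau,0].$$ Let $F(x)=\int_1^x \frac{1}{f(u)}\,du$ for $x>0$. Then $$\lim_{t\to\infty}x(t)=+\infty,\qquad \lim_{t\to\infty}\frac{F(x(t))}{t}=M,$$ and moreover $$\lim_{t\to\infty}\frac{x(t)}{F^{-1}(Mt)}=e^{-\lambda C}.$$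
   Context: Convention: $e^{-\infty}:=0$, so when $\lambda=+\infty$ (and $C>0$) the last limit is $0$. The function $F$ is strictly increasing and $F(x)\to\infty$ as $x\to\infty$ (since $f(x)/x\to0$), so $F^{-1}(Mt)$ is defined for all $t\ge 0$. *)

theory Defs
  imports "HOL-Analysis.Analysis"
begin

text \<open>\<open>delay_solution f \<mu> \<tau> \<psi> x\<close> constrains \<open>x\<close> only on \<open>[-\<tau>, \<infinity>)\<close>. The positivity clause says that
  \<open>x\<close> takes values in \<open>(0, \<infinity>)\<close>, the domain of \<open>f\<close>, so that the right-hand side never involves the
  arbitrary values of the HOL function \<open>f\<close> at nonpositive arguments.\<close>

definition delay_solution ::
  "(real \<Rightarrow> real) \<Rightarrow> real measure \<Rightarrow> real \<Rightarrow> (real \<Rightarrow> real) \<Rightarrow> (real \<Rightarrow> real) \<Rightarrow> bool" where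
  "delay_solution f \<mu> \<tau> \<psi> x \<longleftrightarrow>
     continuous_on {-\<tau>..} x \<and>
     (\<forall>t\<ge>-\<tau>. x t > 0) \<and>
     (\<forall>t>0. (x has_real_derivative (\<integral>s. f (x (t + s)) \<partial>\<mu>)) (at t)) \<and>
     (\<forall>t\<in>{-\<tau>..0}. x t = \<psi> t)"

text \<open>The interval integral is oriented, so the value is \<open>- \<integral>\<^sub>x\<^sup>1 du / f u\<close> for \<open>0 < x < 1\<close>.\<close>

definition F_of :: "(real \<Rightarrow> real) \<Rightarrow> real \<Rightarrow> real" where
  "F_of f x = (LBINT u=ereal 1..ereal x. 1 / f u)"

text \<open>\<open>F_of f\<close> is inverted as a function on \<open>(0, \<infinity>)\<close>.\<close>

definition F_inv :: "(real \<Rightarrow> real) \<Rightarrow> real \<Rightarrow> real" where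
  "F_inv f = inv_into {0<..} (F_of f)"

text \<open>\<open>exp_neg a\<close> is \<open>e\<^sup>-\<^sup>a\<close> for \<open>a \<in> [0, \<infinity>]\<close>, with \<open>e\<^sup>-\<^sup>\<infinity> = 0\<close>.\<close>

definition exp_neg :: "ereal \<Rightarrow> real" where
  "exp_neg a = (if a = \<infinity> then 0 else exp (- real_of_ereal a))"

end

(*
  Put h(t) = ln (f (x t)) and G(t) = M t - F (x t).  Then G'(t) is the mu-integral of
  1 - exp (h(t+s) - h(t)).  Since f' -> 0, the increments h(t) - h(t-tau) vanish in the limit, so G'
  agrees, up to a factor tending to 1, with the integral of h(t) - h(t+s).  The latter is the
  derivative of Phi(t), the mu-integral of the integral of h over [t+s, t], and Phi(t) lies between
  C h(t-tau) and C h(t).  Hence (1-e) C h(t) - K <= G(t) <= C h(t) + K.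

  With y(t) = F^{-1}(M t), G(t) is the integral of 1/f from x(t) to y(t).  If f(u) is close to
  L u / ln u, that integral is about (ln^2 y - ln^2 x) / (2 L), while h(t) is about ln x(t).  This
  forces ln y - ln x -> L C.  One-sided bounds on f suffice for one-sided bounds on ln y - ln x, which
  also covers L = 0 (where G >= -K gives the lower bound) and L = infinity.
*)
theory Submission
  imports Defs "HOL-Real_Asymp.Real_Asymp"
begin

section \<open>Primitives and derivative tests\<close>

lemma has_real_derivative_LBINT:
  fixes k :: "real \<Rightarrow> real"
  assumes cont: "continuous_on {a<..} k" and "a < c" "a < u"
  shows "((\<lambda>u. LBINT y=ereal c..ereal u. k y) has_real_derivative k u) (at u)"
proof -
  \<comment> \<open>The interval from \<open>l\<close> to \<open>r\<close> stays inside the domain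
    and has both \<open>c\<close> and \<open>u\<close> in its interior, so the one-sided fundamental
    theorem yields a two-sided derivative, also for \<open>u < c\<close>.\<close>
  define l where "l = (a + min c u) / 2"
  define r where "r = max c u + 1"
  have lr: "a < l" "l < c" "l < u" "c < r" "u < r"
    using assms by (auto simp: l_def r_def)
  have "continuous_on {l..r} k"
    using cont by (rule continuous_on_subset) (use lr in auto)
  hence "((\<lambda>u. LBINT y=c..u. k y) has_vector_derivative k u) (at u within {l..r})"
    by (intro interval_integral_FTC2) (use lr in auto)
  thus ?thesis
    using lr by (simp add: has_real_derivative_iff_has_vector_derivative at_within_Icc_at)
qed

text \<open>Inequalities between derivatives are integrated below by applying this to a difference
  of two functions.\<close>

lemma nondecreasing_if_deriv_nonneg:
  fixes g :: "real \<Rightarrow> real"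
  assumes "\<And>u. u \<ge> a \<Longrightarrow> (g has_real_derivative g' u) (at u)" "\<And>u. u \<ge> a \<Longrightarrow> g' u \<ge> 0"
    and "a \<le> u" "u \<le> v"
  shows "g u \<le> g v"
  by (rule DERIV_nonneg_imp_nondecreasing[OF \<open>u \<le> v\<close>]) (use assms in \<open>meson order_trans\<close>)

subsection \<open>Growth of positive solutions\<close>

locale delay_growth = finite_measure \<mu> for \<mu> :: "real measure" +
  fixes f f' x :: "real \<Rightarrow> real" and x\<^sub>1 \<tau> M C :: real
  assumes f_deriv: "\<And>y. y > 0 \<Longrightarrow> (f has_real_derivative f' y) (at y)"
    and f_pos: "\<And>y. y > 0 \<Longrightarrow> f y > 0"
    and x1_nonneg: "x\<^sub>1 \<ge> 0"
    and f'_pos: "\<And>y. y > x\<^sub>1 \<Longrightarrow> f' y > 0"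
    and f'_lim: "(f' \<longlongrightarrow> 0) at_top"
    and \<tau>_pos: "\<tau> > 0"
    and \<mu>_sets: "sets \<mu> = sets (restrict_space borel {-\<tau>..0})"
    and M_eq: "M = (\<integral>s. 1 \<partial>\<mu>)"
    and M_pos: "M > 0"
    and C_eq: "C = (\<integral>s. \<bar>s\<bar> \<partial>\<mu>)"
    and C_pos: "C > 0"
    and x_cont: "continuous_on {-\<tau>..} x"
    and x_pos: "\<And>t. t \<ge> -\<tau> \<Longrightarrow> x t > 0"
    and x_deriv: "\<And>t. t > 0 \<Longrightarrow> (x has_real_derivative (\<integral>s. f (x (t + s)) \<partial>\<mu>)) (at t)"
begin

abbreviation F :: "real \<Rightarrow> real" where "F \<equiv> F_of f"

section \<open>Integration of continuous functions against \<mu>\<close>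

lemma space_\<mu>: "space \<mu> = {-\<tau>..0}"
  using sets_eq_imp_space_eq[OF \<mu>_sets] by (simp add: space_restrict_space)

text \<open>Continuous functions are bounded on the compact support interval, and \<mu> is
  finite.\<close>

lemma integrable_continuous:
  fixes g :: "real \<Rightarrow> real"
  assumes "continuous_on {-\<tau>..0} g"
  shows "integrable \<mu> g"
proof -
  have "compact (g ` {-\<tau>..0})"
    by (intro compact_continuous_image assms compact_Icc)
  then obtain B where B: "\<And>s. s \<in> {-\<tau>..0} \<Longrightarrow> norm (g s) \<le> B"
    using compact_imp_bounded bounded_iff by (metis imageI)
  have "g \<in> borel_measurable (restrict_space borel {-\<tau>..0})"
    by (rule borel_measurable_continuous_on_restrict[OF assms])
  hence "g \<in> borel_measurable \<mu>"
    using \<mu>_sets measurable_cong_sets by blast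
  thus ?thesis
    by (intro integrable_const_bound[where B = B]) (use B in \<open>auto simp: space_\<mu>\<close>)
qed

lemma measure_space [simp]: "measure \<mu> (space \<mu>) = M"
  by (simp add: M_eq)

lemma integral_abs_mult: "(\<integral>s. \<bar>s\<bar> * c \<partial>\<mu>) = C * c"
  by (simp add: C_eq)

lemma integral_le:
  fixes g k :: "real \<Rightarrow> real"
  assumes "continuous_on {-\<tau>..0} g" "continuous_on {-\<tau>..0} k"
    and "\<And>s. -\<tau> \<le> s \<Longrightarrow> s \<le> 0 \<Longrightarrow> g s \<le> k s"
  shows "(\<integral>s. g s \<partial>\<mu>) \<le> (\<integral>s. k s \<partial>\<mu>)"
  by (intro integral_mono integrable_continuous assms) (use assms(3) in \<open>auto simp: space_\<mu>\<close>)

lemma continuous_on_shift: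
  fixes g :: "real \<Rightarrow> real"
  assumes "continuous_on A g" "\<And>s. -\<tau> \<le> s \<Longrightarrow> s \<le> 0 \<Longrightarrow> t + s \<in> A"
  shows "continuous_on {-\<tau>..0} (\<lambda>s. g (t + s))"
proof (rule continuous_on_compose2[OF assms(1)])
  show "(+) t ` {-\<tau>..0} \<subseteq> A" using assms(2) by (auto simp del: image_add_atLeastAtMost)
qed (intro continuous_intros)

section \<open>Monotonicity and sublinearity of \<open>f\<close>, and divergence of
  \<open>x\<close>\<close>

lemma f_cont: "continuous_on {0<..} f"
  by (rule DERIV_continuous_on[where D = f']) (auto intro: has_field_derivative_at_within f_deriv)

lemma f_mono: "x\<^sub>1 < a \<Longrightarrow> a \<le> b \<Longrightarrow> f a \<le> f b"
  by (rule nondecreasing_if_deriv_nonneg[of a f f'])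
     (use x1_nonneg f'_pos f_deriv in \<open>auto simp: less_imp_le\<close>)

text \<open>This form of L'Hospital's rule asks only the denominator to diverge, so it applies
  whether or not \<open>f\<close> is bounded.\<close>

lemma f_sublinear: "((\<lambda>u. f u / u) \<longlongrightarrow> 0) at_top"
proof (rule lhospital_at_top_at_top[where g' = "\<lambda>_. 1"])
  show "\<forall>\<^sub>F u in at_top. (f has_real_derivative f' u) (at u)"
    using eventually_gt_at_top[of 0] by eventually_elim (rule f_deriv)
qed (use f'_lim in \<open>auto simp: filterlim_ident\<close>)

lemma eventually_f_le:
  assumes "e > 0"
  shows "\<forall>\<^sub>F u in at_top. f u \<le> e * u"
  using order_tendstoD(2)[OF f_sublinear assms] eventually_gt_at_top[of 0]
  by eventually_elim (simp add: field_simps)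

lemma fx_cont: "continuous_on {-\<tau>..} (\<lambda>t. f (x t))"
  by (rule continuous_on_compose2[OF f_cont x_cont]) (use x_pos in auto)

lemma fx_shift_cont: "t \<ge> 0 \<Longrightarrow> continuous_on {-\<tau>..0} (\<lambda>s. f (x (t + s)))"
  by (rule continuous_on_shift[OF fx_cont]) auto

lemma x'_nonneg: "t \<ge> 0 \<Longrightarrow> (\<integral>s. f (x (t + s)) \<partial>\<mu>) \<ge> 0"
  by (intro Bochner_Integration.integral_nonneg order_less_imp_le[OF f_pos] x_pos) (auto simp: space_\<mu>)

lemma x_mono:
  assumes "0 < a" "a \<le> b"
  shows "x a \<le> x b"
proof (rule nondecreasing_if_deriv_nonneg[of a x "\<lambda>t. \<integral>s. f (x (t + s)) \<partial>\<mu>"])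
  fix t assume "a \<le> t"
  thus "(\<integral>s. f (x (t + s)) \<partial>\<mu>) \<ge> 0"
    using assms by (intro x'_nonneg) auto
qed (use assms x_deriv in auto)

text \<open>Up to \<open>b\<close> the minimum over a compact interval serves; beyond
  \<open>b\<close> monotonicity of \<open>f\<close> takes over.\<close>

lemma f_bounded_below:
  assumes "a > 0"
  obtains c where "c > 0" "\<And>y. y \<ge> a \<Longrightarrow> f y \<ge> c"
proof -
  define b where "b = max a (x\<^sub>1 + 1)"
  have "continuous_on {a..b} f"
    by (rule continuous_on_subset[OF f_cont]) (use assms in auto)
  then obtain m where m: "m \<in> {a..b}" "\<And>y. y \<in> {a..b} \<Longrightarrow> f m \<le> f y"
    using continuous_attains_inf[of "{a..b}" f] by (auto simp: b_def)
  have "f y \<ge> f m" if "y \<ge> a" for y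
  proof (cases "y \<le> b")
    case False
    have "f m \<le> f b" using m by (auto simp: b_def)
    also have "f b \<le> f y" using False by (intro f_mono) (auto simp: b_def)
    finally show ?thesis .
  qed (use m that in auto)
  moreover have "f m > 0" using m assms by (intro f_pos) auto
  ultimately show thesis using that by blast
qed

text \<open>After time \<open>1 + \<tau>\<close> every delayed value is at least \<open>x 1\<close>,
  where \<open>f\<close> is bounded below by some \<open>c > 0\<close>. So \<open>x'\<close> is at
  least \<open>c * M\<close> and \<open>x\<close> grows at least linearly.\<close>

lemma x_at_top: "filterlim x at_top at_top"
proof -
  have "x 1 > 0" using x_pos[of 1] \<tau>_pos by simp
  then obtain c where c: "c > 0" "\<And>y. y \<ge> x 1 \<Longrightarrow> f y \<ge> c"
    using f_bounded_below by blast
  have bound: "x t - c * M * t \<ge> x (1 + \<tau>) - c * M * (1 + \<tau>)" if "t \<ge> 1 + \<tau>" for t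
  proof (rule nondecreasing_if_deriv_nonneg[of "1 + \<tau>" "\<lambda>t. x t - c * M * t"
        "\<lambda>t. (\<integral>s. f (x (t + s)) \<partial>\<mu>) - c * M"])
    fix t assume t: "1 + \<tau> \<le> t"
    show "((\<lambda>t. x t - c * M * t) has_real_derivative (\<integral>s. f (x (t + s)) \<partial>\<mu>) - c * M) (at t)"
      using t \<tau>_pos by (auto intro!: derivative_eq_intros x_deriv)
    have "(\<integral>s. c \<partial>\<mu>) \<le> (\<integral>s. f (x (t + s)) \<partial>\<mu>)"
      by (intro integral_le fx_shift_cont continuous_on_const c x_mono) (use t \<tau>_pos in auto)
    thus "0 \<le> (\<integral>s. f (x (t + s)) \<partial>\<mu>) - c * M" by (simp add: mult.commute)
  qed (use that in auto)
  have "filterlim (\<lambda>t. x (1 + \<tau>) - c * M * (1 + \<tau>) + c * M * t) at_top at_top"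
    using mult_pos_pos[OF c(1) M_pos] by real_asymp
  thus ?thesis
    by (rule filterlim_at_top_mono)
       (use eventually_ge_at_top[of "1 + \<tau>"] in \<open>eventually_elim, use bound in force\<close>)
qed

lemma eventually_x: "eventually P at_top \<Longrightarrow> \<forall>\<^sub>F t in at_top. P (x t)"
  using x_at_top by (simp add: filterlim_iff)

subsection \<open>The logarithm of the growth rate along the solution\<close>

text \<open>From \<open>T\<^sub>0 - \<tau>\<close> on, both \<open>x\<close> and \<open>f\<close>
  along \<open>x\<close> are nondecreasing, so for \<open>t\<close> beyond \<open>T\<^sub>0\<close>
  the whole delay window lies in the monotone regime. The choice operator fixes one such time for
  all later lemmas.\<close>

definition T\<^sub>0 :: real where
  "T\<^sub>0 = (SOME T. T > \<tau> \<and> (\<forall>t \<ge> T - \<tau>. x t > x\<^sub>1))"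

lemma T0: "T\<^sub>0 > \<tau>" "\<And>t. t \<ge> T\<^sub>0 - \<tau> \<Longrightarrow> x t > x\<^sub>1"
proof -
  obtain B where "\<And>t. t \<ge> B \<Longrightarrow> x t > x\<^sub>1"
    using eventually_x[OF eventually_gt_at_top[of x\<^sub>1]] by (auto simp: eventually_at_top_linorder)
  hence "max B 1 + \<tau> > \<tau> \<and> (\<forall>t \<ge> max B 1 + \<tau> - \<tau>. x t > x\<^sub>1)" by auto
  hence "T\<^sub>0 > \<tau> \<and> (\<forall>t \<ge> T\<^sub>0 - \<tau>. x t > x\<^sub>1)" unfolding T\<^sub>0_def by (rule someI)
  thus "T\<^sub>0 > \<tau>" "\<And>t. t \<ge> T\<^sub>0 - \<tau> \<Longrightarrow> x t > x\<^sub>1" by auto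
qed

text \<open>In these terms the ratio of \<open>f (x (t + s))\<close> to \<open>f (x t)\<close> is
  the exponential of an increment of \<open>h\<close>.\<close>

definition h :: "real \<Rightarrow> real" where "h t = ln (f (x t))"

lemma fx_pos: "t \<ge> -\<tau> \<Longrightarrow> f (x t) > 0"
  by (intro f_pos x_pos)

lemma exp_h: "t \<ge> -\<tau> \<Longrightarrow> exp (h t) = f (x t)"
  by (simp add: h_def fx_pos)

lemma h_cont: "continuous_on {-\<tau>..} h"
  unfolding h_def by (intro continuous_intros fx_cont) (use fx_pos in force)

lemma h_shift_cont: "t \<ge> 0 \<Longrightarrow> continuous_on {-\<tau>..0} (\<lambda>s. h (t + s))"
  by (rule continuous_on_shift[OF h_cont]) auto

lemma h_mono:
  assumes "T\<^sub>0 - \<tau> \<le> a" "a \<le> b"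
  shows "h a \<le> h b"
proof -
  have "f (x a) \<le> f (x b)"
    using assms T0 \<tau>_pos by (intro f_mono x_mono) auto
  moreover have "f (x a) > 0"
    using assms T0(1) \<tau>_pos by (intro fx_pos) auto
  ultimately show ?thesis by (simp add: h_def)
qed

lemma h_deriv:
  assumes "t > 0"
  shows "(h has_real_derivative f' (x t) * ((\<integral>s. f (x (t + s)) \<partial>\<mu>) / f (x t))) (at t)"
proof -
  have "((\<lambda>t. f (x t)) has_real_derivative f' (x t) * (\<integral>s. f (x (t + s)) \<partial>\<mu>)) (at t)"
    by (rule DERIV_chain2[OF f_deriv x_deriv]) (use assms \<tau>_pos x_pos in auto)
  thus ?thesis unfolding h_def
    using assms \<tau>_pos fx_pos[of t] by (auto intro!: derivative_eq_intros)
qed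

lemma rate_le:
  assumes "t \<ge> T\<^sub>0"
  shows "(\<integral>s. f (x (t + s)) \<partial>\<mu>) / f (x t) \<le> M"
proof -
  have "(\<integral>s. f (x (t + s)) \<partial>\<mu>) \<le> (\<integral>s. f (x t) \<partial>\<mu>)"
    by (intro integral_le fx_shift_cont continuous_on_const f_mono x_mono T0(2))
       (use assms T0(1) \<tau>_pos in auto)
  thus ?thesis
    using fx_pos[of t] assms T0(1) \<tau>_pos by (simp add: field_simps)
qed

text \<open>The derivative of \<open>h\<close> is \<open>f' (x t)\<close>, which tends to 0, times a
  rate bounded by \<open>M\<close>; the window has fixed length \<tau>.\<close>

lemma h_increment_small:
  assumes "e > 0"
  shows "\<forall>\<^sub>F t in at_top. h t - h (t - \<tau>) < e"
proof -
  \<comment> \<open>Chosen so that the bound \<open>d * M\<close> on the slope, over a window of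
    length \<tau>, gives \<open>e / 2\<close>.\<close>
  define d where "d = e / (2 * M * \<tau>)"
  have "d > 0" using assms M_pos \<tau>_pos by (simp add: d_def)
  from eventually_x[OF order_tendstoD(2)[OF f'_lim this]] obtain B
    where B: "\<And>t. t \<ge> B \<Longrightarrow> f' (x t) < d" by (auto simp: eventually_at_top_linorder)
  define A where "A = max B T\<^sub>0"
  have A: "A > 0" using T0 \<tau>_pos by (auto simp: A_def)
  have "h t - h (t - \<tau>) < e" if t: "t \<ge> A + \<tau>" for t
  proof -
    have "d * M * (t - \<tau>) - h (t - \<tau>) \<le> d * M * t - h t"
    proof (rule nondecreasing_if_deriv_nonneg[of A "\<lambda>t. d * M * t - h t"
        "\<lambda>t. d * M - f' (x t) * ((\<integral>s. f (x (t + s)) \<partial>\<mu>) / f (x t))"])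
      fix u assume u: "A \<le> u"
      show "((\<lambda>t. d * M * t - h t) has_real_derivative
          d * M - f' (x u) * ((\<integral>s. f (x (u + s)) \<partial>\<mu>) / f (x u))) (at u)"
        using u A by (auto intro!: derivative_eq_intros h_deriv)
      have "f' (x u) * ((\<integral>s. f (x (u + s)) \<partial>\<mu>) / f (x u)) \<le> d * M"
      proof (rule mult_mono)
        show "f' (x u) \<le> d" using B[of u] u by (auto simp: A_def)
        show "(\<integral>s. f (x (u + s)) \<partial>\<mu>) / f (x u) \<le> M"
          using u by (intro rate_le) (auto simp: A_def)
        show "0 \<le> (\<integral>s. f (x (u + s)) \<partial>\<mu>) / f (x u)"
          using u A \<tau>_pos fx_pos[of u] by (intro divide_nonneg_nonneg x'_nonneg) auto
      qed (use \<open>d > 0\<close> in auto)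
      thus "0 \<le> d * M - f' (x u) * ((\<integral>s. f (x (u + s)) \<partial>\<mu>) / f (x u))" by simp
    qed (use t \<tau>_pos in auto)
    hence "h t - h (t - \<tau>) \<le> d * M * \<tau>" by (simp add: algebra_simps)
    also have "\<dots> = e / 2" using M_pos \<tau>_pos by (simp add: d_def)
    finally show ?thesis using assms by simp
  qed
  thus ?thesis by (auto simp: eventually_at_top_linorder)
qed

lemma F_deriv: "u > 0 \<Longrightarrow> (F has_real_derivative 1 / f u) (at u)"
  unfolding F_of_def[abs_def]
  by (rule has_real_derivative_LBINT[where a = 0])
     (use f_pos in \<open>force intro!: continuous_intros f_cont\<close>)+

lemma F_strict_mono:
  assumes "0 < a" "a < b"
  shows "F a < F b"
proof (rule DERIV_pos_imp_increasing[OF assms(2)])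
  fix u assume "a \<le> u"
  hence "u > 0" using assms by simp
  thus "\<exists>D. (F has_real_derivative D) (at u) \<and> D > 0"
    using F_deriv f_pos by (intro exI[of _ "1 / f u"]) simp
qed

lemma F_x_deriv:
  "t > 0 \<Longrightarrow> ((\<lambda>t. F (x t)) has_real_derivative (\<integral>s. f (x (t + s)) \<partial>\<mu>) / f (x t)) (at t)"
  using DERIV_chain2[OF F_deriv x_deriv, of t] x_pos[of t] \<tau>_pos by simp

subsection \<open>Comparison of \<open>M t - F (x t)\<close> with \<open>C h(t)\<close>\<close>

definition H :: "real \<Rightarrow> real" where
  "H u = (LBINT r=ereal 0..ereal u. h r)"

lemma H_deriv: "u > -\<tau> \<Longrightarrow> (H has_real_derivative h u) (at u)"
  unfolding H_def[abs_def]
  by (rule has_real_derivative_LBINT[where a = "-\<tau>"])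
     (use \<tau>_pos in \<open>auto intro: continuous_on_subset[OF h_cont]\<close>)

lemma H_cont: "continuous_on {-\<tau><..} H"
  by (rule DERIV_continuous_on[where D = h]) (auto intro: has_field_derivative_at_within H_deriv)

lemma H_shift_cont: "t > 0 \<Longrightarrow> continuous_on {-\<tau>..0} (\<lambda>s. H (t + s))"
  by (rule continuous_on_shift[OF H_cont]) auto

text \<open>Differentiation under the integral sign: by the mean value theorem and uniform
  continuity of \<open>h\<close> on a compact set, the difference quotients converge uniformly in
  \<open>s\<close>.\<close>

lemma H_average_deriv:
  assumes "t > 0"
  shows "((\<lambda>t. \<integral>s. H (t + s) \<partial>\<mu>) has_real_derivative (\<integral>s. h (t + s) \<partial>\<mu>)) (at t)"
  unfolding DERIV_def
proof (rule LIM_I)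
  fix r :: real assume "r > 0"
  define e where "e = r / (2 * M)"
  have "e > 0" using \<open>r > 0\<close> M_pos by (simp add: e_def)
  \<comment> \<open>Contains every \<open>t + s\<close> and \<open>t + k + s\<close> with
    \<open>s\<close> in the delay window and \<open>\<bar>k\<bar> < t / 2\<close>, hence also the
    intermediate points.\<close>
  define K where "K = {t / 2 - \<tau>..2 * t}"
  have "continuous_on K h"
    by (rule continuous_on_subset[OF h_cont]) (use assms in \<open>auto simp: K_def\<close>)
  hence "uniformly_continuous_on K h"
    by (rule compact_uniformly_continuous) (simp add: K_def)
  then obtain d where d: "d > 0" "\<And>u v. u \<in> K \<Longrightarrow> v \<in> K \<Longrightarrow> dist u v < d \<Longrightarrow> dist (h u) (h v) < e"
    using \<open>e > 0\<close> unfolding uniformly_continuous_on_def by metis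
  show "\<exists>\<delta>>0. \<forall>k. k \<noteq> 0 \<and> norm (k - 0) < \<delta> \<longrightarrow>
      norm (((\<integral>s. H (t + k + s) \<partial>\<mu>) - (\<integral>s. H (t + s) \<partial>\<mu>)) / k - (\<integral>s. h (t + s) \<partial>\<mu>)) < r"
  proof (intro exI conjI allI impI)
    show "min d (t / 2) > 0" using d assms by simp
    fix k :: real assume k: "k \<noteq> 0 \<and> norm (k - 0) < min d (t / 2)"
    have quotient: "\<bar>(H (t + k + s) - H (t + s)) / k - h (t + s)\<bar> \<le> e" if s: "-\<tau> \<le> s" "s \<le> 0" for s
    proof -
      \<comment> \<open>Ordering the endpoints treats both signs of \<open>k\<close> at
        once.\<close>
      define a b where "a = min (t + s) (t + k + s)" and "b = max (t + s) (t + k + s)"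
      have ab: "a < b" using k by (auto simp: a_def b_def)
      have "\<exists>z. a < z \<and> z < b \<and> H b - H a = (b - a) * h z"
        using ab by (rule MVT2) (use k s assms in \<open>auto simp: a_def b_def intro!: H_deriv\<close>)
      then obtain z where z: "a < z" "z < b" "H b - H a = (b - a) * h z" by auto
      have "(H (t + k + s) - H (t + s)) / k = h z"
        using z(3) k by (cases "k > 0") (auto simp: a_def b_def field_simps min_def max_def)
      moreover have "dist (h z) (h (t + s)) < e"
        by (rule d(2)) (use k s assms z in \<open>auto simp: a_def b_def K_def dist_real_def\<close>)
      ultimately show ?thesis by (simp add: dist_real_def)
    qed
    have contH: "continuous_on {-\<tau>..0} (\<lambda>s. H (t + k + s))" "continuous_on {-\<tau>..0} (\<lambda>s. H (t + s))"
      "continuous_on {-\<tau>..0} (\<lambda>s. h (t + s))"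
      using k assms by (intro H_shift_cont h_shift_cont; auto)+
    have contQ: "continuous_on {-\<tau>..0} (\<lambda>s. \<bar>(H (t + k + s) - H (t + s)) / k - h (t + s)\<bar>)"
      using k by (intro continuous_intros contH) auto
    have eq: "((\<integral>s. H (t + k + s) \<partial>\<mu>) - (\<integral>s. H (t + s) \<partial>\<mu>)) / k - (\<integral>s. h (t + s) \<partial>\<mu>)
        = (\<integral>s. (H (t + k + s) - H (t + s)) / k - h (t + s) \<partial>\<mu>)"
      using contH by (simp add: Bochner_Integration.integral_diff integrable_continuous)
    have "\<bar>\<integral>s. (H (t + k + s) - H (t + s)) / k - h (t + s) \<partial>\<mu>\<bar>
        \<le> (\<integral>s. \<bar>(H (t + k + s) - H (t + s)) / k - h (t + s)\<bar> \<partial>\<mu>)"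
      by (rule integral_abs_bound)
    also have "\<dots> \<le> (\<integral>s. e \<partial>\<mu>)"
      by (rule integral_le[OF contQ continuous_on_const quotient])
    also have "\<dots> < r" using \<open>r > 0\<close> M_pos by (simp add: e_def)
    finally show "norm (((\<integral>s. H (t + k + s) \<partial>\<mu>) - (\<integral>s. H (t + s) \<partial>\<mu>)) / k
        - (\<integral>s. h (t + s) \<partial>\<mu>)) < r" unfolding eq real_norm_def .
  qed
qed

definition G :: "real \<Rightarrow> real" where "G t = M * t - F (x t)"

text \<open>\<open>\<Phi> t = \<integral>\<integral>\<^sub>t\<^sub>+\<^sub>s\<^sup>t h(r) dr \<mu>(ds)\<close>, written without the inner integral so that no Fubini argument is needed.\<close>

definition \<Phi> :: "real \<Rightarrow> real" where "\<Phi> t = M * H t - (\<integral>s. H (t + s) \<partial>\<mu>)"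

lemma G_deriv:
  assumes "t > 0"
  shows "(G has_real_derivative (\<integral>s. 1 - exp (h (t + s) - h t) \<partial>\<mu>)) (at t)"
proof -
  have "(\<integral>s. f (x (t + s)) / f (x t) \<partial>\<mu>) = (\<integral>s. exp (h (t + s) - h t) \<partial>\<mu>)"
    by (rule Bochner_Integration.integral_cong)
       (use assms \<tau>_pos in \<open>auto simp: exp_diff exp_h space_\<mu>\<close>)
  moreover have "integrable \<mu> (\<lambda>s. exp (h (t + s) - h t))"
    using assms by (intro integrable_continuous continuous_intros h_shift_cont) auto
  ultimately have "(\<integral>s. 1 - exp (h (t + s) - h t) \<partial>\<mu>) = M - (\<integral>s. f (x (t + s)) \<partial>\<mu>) / f (x t)"
    by simp
  thus ?thesis unfolding G_def[abs_def]
    using assms by (auto intro!: derivative_eq_intros F_x_deriv)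
qed

lemma \<Phi>_deriv:
  assumes "t > 0"
  shows "(\<Phi> has_real_derivative (\<integral>s. h t - h (t + s) \<partial>\<mu>)) (at t)"
proof -
  have "integrable \<mu> (\<lambda>s. h (t + s))"
    using assms by (intro integrable_continuous h_shift_cont) auto
  hence "(\<integral>s. h t - h (t + s) \<partial>\<mu>) = M * h t - (\<integral>s. h (t + s) \<partial>\<mu>)" by simp
  thus ?thesis unfolding \<Phi>_def[abs_def]
    using assms \<tau>_pos by (auto intro!: derivative_eq_intros H_deriv H_average_deriv)
qed

text \<open>By the mean value theorem \<open>H t - H (t + s)\<close> is \<open>\<bar>s\<bar>\<close>
  times a value of \<open>h\<close> in the window, and \<open>h\<close> is monotone there.
  Integrating \<open>\<bar>s\<bar>\<close> produces \<open>C\<close>.\<close>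

lemma \<Phi>_bounds:
  assumes t: "t \<ge> T\<^sub>0"
  shows "C * h (t - \<tau>) \<le> \<Phi> t" "\<Phi> t \<le> C * h t"
proof -
  have "t > 0" using t T0(1) \<tau>_pos by simp
  note cont = H_shift_cont[OF this]
  have eq: "\<Phi> t = (\<integral>s. H t - H (t + s) \<partial>\<mu>)"
    using integrable_continuous[OF cont] by (simp add: \<Phi>_def)
  have *: "\<bar>s\<bar> * h (t - \<tau>) \<le> H t - H (t + s) \<and> H t - H (t + s) \<le> \<bar>s\<bar> * h t"
    if s: "-\<tau> \<le> s" "s \<le> 0" for s
  proof (cases "s = 0")
    case False
    have "\<exists>z. t + s < z \<and> z < t \<and> H t - H (t + s) = (t - (t + s)) * h z"
      by (rule MVT2) (use False s \<open>t > 0\<close> in \<open>auto intro!: H_deriv\<close>)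
    then obtain z where z: "t + s < z" "z < t" "H t - H (t + s) = \<bar>s\<bar> * h z" using s by auto
    have "h (t - \<tau>) \<le> h z" "h z \<le> h t"
      using z s t by (auto intro!: h_mono)
    thus ?thesis unfolding z(3) by (auto intro: mult_left_mono)
  qed simp
  have "(\<integral>s. \<bar>s\<bar> * h (t - \<tau>) \<partial>\<mu>) \<le> (\<integral>s. H t - H (t + s) \<partial>\<mu>)"
    "(\<integral>s. H t - H (t + s) \<partial>\<mu>) \<le> (\<integral>s. \<bar>s\<bar> * h t \<partial>\<mu>)"
    using * by (intro integral_le continuous_intros cont; blast)+
  thus "C * h (t - \<tau>) \<le> \<Phi> t" "\<Phi> t \<le> C * h t"
    unfolding eq integral_abs_mult .
qed

text \<open>Since \<open>1 - exp (- w) \<le> w\<close>, the derivative of \<open>G\<close> never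
  exceeds that of \<open>\<Phi>\<close>.\<close>

lemma G_le:
  assumes t: "t \<ge> T\<^sub>0"
  shows "G t \<le> C * h t + (G T\<^sub>0 - \<Phi> T\<^sub>0)"
proof -
  have "\<Phi> T\<^sub>0 - G T\<^sub>0 \<le> \<Phi> t - G t"
  proof (rule nondecreasing_if_deriv_nonneg[of "T\<^sub>0" "\<lambda>t. \<Phi> t - G t"])
    fix u assume u: "T\<^sub>0 \<le> u"
    hence "u > 0" using T0(1) \<tau>_pos by simp
    thus "((\<lambda>t. \<Phi> t - G t) has_real_derivative
        (\<integral>s. h u - h (u + s) \<partial>\<mu>) - (\<integral>s. 1 - exp (h (u + s) - h u) \<partial>\<mu>)) (at u)"
      by (intro DERIV_diff G_deriv \<Phi>_deriv)
    have "1 - exp (h (u + s) - h u) \<le> h u - h (u + s)" for s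
      using exp_ge_add_one_self[of "h (u + s) - h u"] by linarith
    hence "(\<integral>s. 1 - exp (h (u + s) - h u) \<partial>\<mu>) \<le> (\<integral>s. h u - h (u + s) \<partial>\<mu>)"
      using \<open>u > 0\<close> by (intro integral_le continuous_intros h_shift_cont) auto
    thus "0 \<le> (\<integral>s. h u - h (u + s) \<partial>\<mu>) - (\<integral>s. 1 - exp (h (u + s) - h u) \<partial>\<mu>)" by simp
  qed (use t in auto)
  thus ?thesis using \<Phi>_bounds(2)[OF t] by simp
qed

text \<open>Monotonicity of \<open>h\<close> makes the integrand of \<open>G'\<close> nonnegative.
  This bounds \<open>G\<close> below even when \<open>f\<close> has no lower bound of order
  \<open>u / ln u\<close>.\<close>

lemma G_mono:
  assumes "T\<^sub>0 \<le> a" "a \<le> b"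
  shows "G a \<le> G b"
proof (rule nondecreasing_if_deriv_nonneg[of a G "\<lambda>u. \<integral>s. 1 - exp (h (u + s) - h u) \<partial>\<mu>"])
  fix u assume u: "a \<le> u"
  hence "u > 0" using T0(1) \<tau>_pos assms by simp
  have "h (u + s) \<le> h u" if "-\<tau> \<le> s" "s \<le> 0" for s
    using that u assms by (intro h_mono) auto
  thus "0 \<le> (\<integral>s. 1 - exp (h (u + s) - h u) \<partial>\<mu>)"
    by (intro Bochner_Integration.integral_nonneg) (auto simp: space_\<mu>)
qed (use assms T0(1) \<tau>_pos in \<open>auto intro!: G_deriv\<close>)

text \<open>For \<open>0 \<le> w \<le> e\<close> one has
  \<open>(1 - e) * w \<le> 1 - exp (- w)\<close>, and the increments of \<open>h\<close> over the
  window are eventually below \<open>e\<close>. So \<open>G' \<ge> (1 - e) * \<Phi>'\<close>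
  eventually.\<close>

lemma G_ge:
  assumes e: "0 < e" "e < 1"
  obtains K where "\<forall>\<^sub>F t in at_top. (1 - e) * C * h t - K \<le> G t"
proof -
  obtain B where B: "\<And>t. t \<ge> B \<Longrightarrow> h t - h (t - \<tau>) < e"
    using h_increment_small[OF e(1)] by (auto simp: eventually_at_top_linorder)
  define A where "A = max B T\<^sub>0"
  \<comment> \<open>The summand \<open>C\<close> absorbs the loss \<open>(1 - e) * C * e\<close>
    from replacing \<open>h (t - \<tau>)\<close> by \<open>h t - e\<close>.\<close>
  define K where "K = C + ((1 - e) * \<Phi> A - G A)"
  have "(1 - e) * C * h t - K \<le> G t" if t: "t \<ge> A" for t
  proof -
    have "G A - (1 - e) * \<Phi> A \<le> G t - (1 - e) * \<Phi> t"
    proof (rule nondecreasing_if_deriv_nonneg[of A "\<lambda>t. G t - (1 - e) * \<Phi> t"])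
      fix u assume u: "A \<le> u"
      hence "u > 0" using T0(1) \<tau>_pos by (simp add: A_def)
      thus "((\<lambda>t. G t - (1 - e) * \<Phi> t) has_real_derivative
        (\<integral>s. 1 - exp (h (u + s) - h u) \<partial>\<mu>) - (1 - e) * (\<integral>s. h u - h (u + s) \<partial>\<mu>)) (at u)"
        by (intro DERIV_diff DERIV_cmult G_deriv \<Phi>_deriv)
      have "(1 - e) * (h u - h (u + s)) \<le> 1 - exp (h (u + s) - h u)" if s: "-\<tau> \<le> s" "s \<le> 0" for s
      proof -
        define w where "w = h u - h (u + s)"
        have "h (u + s) \<le> h u" using s u by (intro h_mono) (auto simp: A_def)
        moreover have "h (u - \<tau>) \<le> h (u + s)" using s u by (intro h_mono) (auto simp: A_def)
        ultimately have w: "0 \<le> w" "w \<le> e" using B[of u] u by (auto simp: w_def A_def)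
        \<comment> \<open>Bounding \<open>exp (- w)\<close> by \<open>1 / (1 + w)\<close> reduces
          the claim to this polynomial identity.\<close>
        have "(1 - (1 - e) * w) * (1 + w) = 1 + w * (e - w) + e * (w * w)" by (simp add: algebra_simps)
        also have "\<dots> \<ge> 1" using w e by simp
        finally have "1 / (1 + w) \<le> 1 - (1 - e) * w" using w by (simp add: field_simps)
        moreover have "exp (- w) \<le> 1 / (1 + w)"
          using exp_ge_add_one_self[of w] w by (simp add: exp_minus field_simps)
        ultimately show ?thesis by (simp add: w_def)
      qed
      hence "(\<integral>s. (1 - e) * (h u - h (u + s)) \<partial>\<mu>) \<le> (\<integral>s. 1 - exp (h (u + s) - h u) \<partial>\<mu>)"
        using \<open>u > 0\<close> by (intro integral_le continuous_intros h_shift_cont) auto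
      thus "0 \<le> (\<integral>s. 1 - exp (h (u + s) - h u) \<partial>\<mu>) - (1 - e) * (\<integral>s. h u - h (u + s) \<partial>\<mu>)"
        by (simp only: integral_mult_right_zero)
    qed (use t in auto)
    moreover have "(1 - e) * (C * (h t - e)) \<le> (1 - e) * \<Phi> t"
    proof (rule mult_left_mono)
      have "C * (h t - e) \<le> C * h (t - \<tau>)"
        using B[of t] t C_pos by (auto simp: A_def)
      also have "\<dots> \<le> \<Phi> t" using t by (intro \<Phi>_bounds) (auto simp: A_def)
      finally show "C * (h t - e) \<le> \<Phi> t" .
    qed (use e in auto)
    moreover have "(1 - e) * (C * e) \<le> C"
    proof -
      have "(1 - e) * e \<le> 1 * 1" using e by (intro mult_mono) auto
      thus ?thesis using mult_left_mono[of "(1 - e) * e" 1 C] C_pos by (simp add: mult_ac)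
    qed
    ultimately show ?thesis by (simp add: K_def algebra_simps)
  qed
  hence "\<forall>\<^sub>F t in at_top. (1 - e) * C * h t - K \<le> G t"
    by (auto simp: eventually_at_top_linorder)
  thus thesis by (rule that)
qed

text \<open>The derivative of \<open>F (x t)\<close> lies between
  \<open>M * exp (h (t - \<tau>) - h t)\<close> and \<open>M\<close>, hence tends to
  \<open>M\<close>; L'Hospital's rule passes this to the quotient by \<open>t\<close>.\<close>

lemma F_over_t: "((\<lambda>t. F (x t) / t) \<longlongrightarrow> M) at_top"
proof -
  have "((\<lambda>t. (\<integral>s. f (x (t + s)) \<partial>\<mu>) / f (x t)) \<longlongrightarrow> M) at_top"
  proof (rule tendstoI)
    fix r :: real assume "r > 0"
    hence "r / M > 0" using M_pos by simp
    show "\<forall>\<^sub>F t in at_top. dist ((\<integral>s. f (x (t + s)) \<partial>\<mu>) / f (x t)) M < r"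
      using h_increment_small[OF \<open>r / M > 0\<close>] eventually_ge_at_top[of T\<^sub>0]
    proof eventually_elim
      case (elim t)
      have "t > 0" using elim T0(1) \<tau>_pos by simp
      have "exp (h (t - \<tau>) - h t) \<le> f (x (t + s)) / f (x t)" if s: "-\<tau> \<le> s" "s \<le> 0" for s
        using s elim T0(1) \<tau>_pos by (simp flip: exp_h exp_diff add: h_mono)
      hence "(\<integral>s. exp (h (t - \<tau>) - h t) \<partial>\<mu>) \<le> (\<integral>s. f (x (t + s)) / f (x t) \<partial>\<mu>)"
        using fx_pos[of t] \<open>t > 0\<close> \<tau>_pos
        by (intro integral_le continuous_intros fx_shift_cont) auto
      hence "M * exp (h (t - \<tau>) - h t) \<le> (\<integral>s. f (x (t + s)) \<partial>\<mu>) / f (x t)" by simp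
      moreover have "M - r < M * exp (h (t - \<tau>) - h t)"
      proof -
        have "1 - r / M < exp (h (t - \<tau>) - h t)"
          using elim exp_ge_add_one_self[of "h (t - \<tau>) - h t"] by linarith
        thus ?thesis using M_pos by (simp add: field_simps)
      qed
      ultimately show ?case using rate_le[of t] elim by (simp add: dist_real_def)
    qed
  qed
  hence *: "((\<lambda>t. (\<integral>s. f (x (t + s)) \<partial>\<mu>) / f (x t) / 1) \<longlongrightarrow> M) at_top" by simp
  show ?thesis
  proof (rule lhospital_at_top_at_top[OF _ _ _ _ *])
    show "\<forall>\<^sub>F t in at_top. ((\<lambda>t. F (x t)) has_real_derivative
        (\<integral>s. f (x (t + s)) \<partial>\<mu>) / f (x t)) (at t)"
      using eventually_gt_at_top[of 0] by eventually_elim (rule F_x_deriv)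
  qed (auto simp: filterlim_ident)
qed

subsection \<open>The inverse of \<open>F\<close> and the logarithmic gap\<close>

lemma F_one: "F 1 = 0"
  by (simp add: F_of_def)

lemma F_mono: "0 < a \<Longrightarrow> a \<le> b \<Longrightarrow> F a \<le> F b"
  using F_strict_mono[of a b] by (cases "a = b") auto

text \<open>The hypothesis says \<open>1 / u \<le> e / f u\<close>; this is its integrated
  form.\<close>

lemma ln_diff_le_F_diff:
  assumes "e > 0" "a > 0" "\<And>u. u \<ge> a \<Longrightarrow> f u \<le> e * u" "a \<le> u" "u \<le> v"
  shows "ln v - ln u \<le> e * (F v - F u)"
proof -
  have "e * F u - ln u \<le> e * F v - ln v"
  proof (rule nondecreasing_if_deriv_nonneg[OF _ _ assms(4,5)])
    fix w assume w: "a \<le> w"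
    hence "w > 0" using assms by simp
    thus "((\<lambda>w. e * F w - ln w) has_real_derivative e * (1 / f w) - 1 / w) (at w)"
      by (auto intro!: derivative_eq_intros F_deriv simp: divide_inverse)
    show "0 \<le> e * (1 / f w) - 1 / w"
      using assms(3)[OF w] f_pos[OF \<open>w > 0\<close>] \<open>w > 0\<close> by (simp add: field_simps)
  qed
  thus ?thesis by (simp add: algebra_simps)
qed

text \<open>The derivative of \<open>(ln u)\<^sup>2\<close> is \<open>2 * ln u / u\<close>, which
  the bound on \<open>f\<close> compares with \<open>2 * q / f u\<close>.\<close>

lemma ln_sq_diff_le_F_diff:
  assumes "q > 0" "a > 1" "\<And>u. u \<ge> a \<Longrightarrow> f u \<le> q * (u / ln u)" "a \<le> u" "u \<le> v"
  shows "(ln v)\<^sup>2 - (ln u)\<^sup>2 \<le> 2 * q * (F v - F u)"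
proof -
  have "2 * q * F u - (ln u)\<^sup>2 \<le> 2 * q * F v - (ln v)\<^sup>2"
  proof (rule nondecreasing_if_deriv_nonneg[OF _ _ assms(4,5)])
    fix w assume w: "a \<le> w"
    hence "w > 1" using assms by simp
    thus "((\<lambda>w. 2 * q * F w - (ln w)\<^sup>2) has_real_derivative 2 * q * (1 / f w) - 2 * ln w * (1 / w)) (at w)"
      by (auto intro!: derivative_eq_intros F_deriv simp: divide_inverse)
    have "f w > 0" "ln w > 0" using \<open>w > 1\<close> f_pos by auto
    thus "0 \<le> 2 * q * (1 / f w) - 2 * ln w * (1 / w)"
      using assms(3)[OF w] \<open>w > 1\<close> by (simp add: field_simps)
  qed
  thus ?thesis by (simp add: algebra_simps)
qed

lemma F_diff_le_ln_sq_diff: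
  assumes "a > 1" "\<And>u. u \<ge> a \<Longrightarrow> p * (u / ln u) \<le> f u" "a \<le> u" "u \<le> v"
  shows "2 * p * (F v - F u) \<le> (ln v)\<^sup>2 - (ln u)\<^sup>2"
proof -
  have "(ln u)\<^sup>2 - 2 * p * F u \<le> (ln v)\<^sup>2 - 2 * p * F v"
  proof (rule nondecreasing_if_deriv_nonneg[OF _ _ assms(3,4)])
    fix w assume w: "a \<le> w"
    hence "w > 1" using assms by simp
    thus "((\<lambda>w. (ln w)\<^sup>2 - 2 * p * F w) has_real_derivative 2 * ln w * (1 / w) - 2 * p * (1 / f w)) (at w)"
      by (auto intro!: derivative_eq_intros F_deriv simp: divide_inverse)
    have "f w > 0" "ln w > 0" using \<open>w > 1\<close> f_pos by auto
    thus "0 \<le> 2 * ln w * (1 / w) - 2 * p * (1 / f w)"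
      using assms(2)[OF w] \<open>w > 1\<close> by (simp add: field_simps)
  qed
  thus ?thesis by (simp add: algebra_simps)
qed

lemma F_at_top: "filterlim F at_top at_top"
proof -
  obtain a where a: "\<And>u. u \<ge> a \<Longrightarrow> f u \<le> 1 * u"
    using eventually_f_le[of 1] by (auto simp: eventually_at_top_linorder)
  define b where "b = max a 1"
  define c where "c = F b - ln b"
  have "filterlim (\<lambda>u. ln u + c) at_top at_top" by real_asymp
  moreover have "\<forall>\<^sub>F u in at_top. ln u + c \<le> F u"
    using eventually_ge_at_top[of b]
  proof eventually_elim
    case (elim u)
    thus ?case using ln_diff_le_F_diff[of 1 b b u] a by (force simp: b_def c_def)
  qed
  ultimately show ?thesis by (rule filterlim_at_top_mono)
qed

text \<open>As \<open>F 1 = 0\<close>, a nonnegative value is reached to the right of 1 by the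
  intermediate value theorem; the behaviour of \<open>F\<close> near 0 does not enter.\<close>

lemma F_inv_props:
  assumes "v \<ge> 0"
  shows "F_inv f v > 0" "F (F_inv f v) = v"
proof -
  have "\<forall>\<^sub>F u in at_top. v \<le> F u \<and> 1 \<le> u"
    using F_at_top eventually_ge_at_top[of 1] by (auto simp: filterlim_at_top eventually_conj_iff)
  then obtain u where u: "v \<le> F u" "1 \<le> u" by (auto simp: eventually_at_top_linorder)
  have "\<exists>w\<ge>1. w \<le> u \<and> F w = v"
  proof (rule IVT')
    show "continuous_on {1..u} F"
      by (rule DERIV_continuous_on[where D = "\<lambda>u. 1 / f u"])
         (force intro!: has_field_derivative_at_within[OF F_deriv])
  qed (use u assms F_one in auto)
  then obtain w where "w \<ge> 1" "F w = v" by auto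
  hence "v \<in> F ` {0<..}" by force
  thus "F_inv f v > 0" "F (F_inv f v) = v"
    unfolding F_inv_def using inv_into_into[of v F "{0<..}"] f_inv_into_f[of v F "{0<..}"] by auto
qed

definition y :: "real \<Rightarrow> real" where "y t = F_inv f (M * t)"

lemma y_pos: "t \<ge> 0 \<Longrightarrow> y t > 0" and F_y: "t \<ge> 0 \<Longrightarrow> F (y t) = M * t"
  using F_inv_props[of "M * t"] M_pos by (auto simp: y_def)

lemma G_eq: "t \<ge> 0 \<Longrightarrow> G t = F (y t) - F (x t)"
  by (simp add: G_def F_y)

lemma y_at_top: "filterlim y at_top at_top"
  unfolding filterlim_at_top
proof
  fix B :: real
  have "filterlim (\<lambda>t. M * t) at_top at_top" using M_pos by real_asymp
  hence "\<forall>\<^sub>F t in at_top. M * t \<ge> F (max B 1)" by (simp add: filterlim_at_top)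
  thus "\<forall>\<^sub>F t in at_top. B \<le> y t"
    using eventually_ge_at_top[of 0]
  proof eventually_elim
    case (elim t)
    show ?case
    proof (rule ccontr)
      assume "\<not> B \<le> y t"
      hence "F (y t) < F (max B 1)" using y_pos[of t] elim by (intro F_strict_mono) auto
      thus False using F_y[of t] elim by simp
    qed
  qed
qed

section \<open>Asymptotics of the gap \<open>ln y - ln x\<close>\<close>

definition z :: "real \<Rightarrow> real" where "z t = ln (y t) - ln (x t)"

lemma ln_sq_y: "(ln (y t))\<^sup>2 - (ln (x t))\<^sup>2 = z t * (z t + 2 * ln (x t))"
  by (simp add: z_def power2_eq_square algebra_simps)

lemma x_le_y_iff: "t \<ge> 0 \<Longrightarrow> x t \<le> y t \<longleftrightarrow> z t \<ge> 0"
  using x_pos[of t] y_pos[of t] \<tau>_pos by (simp add: z_def)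

text \<open>If \<open>z t \<ge> K\<close>, then \<open>2 * K * ln (x t) \<le> 2 * q * G t\<close>,
  while \<open>G t \<le> C * ln (x t) + R\<close>. So \<open>(K / q - C) * ln (x t) \<le> R\<close>,
  which fails for large \<open>t\<close>.\<close>

lemma z_upper:
  assumes q: "q > 0" "\<forall>\<^sub>F u in at_top. f u \<le> q * (u / ln u)" and K: "K > q * C"
  shows "\<forall>\<^sub>F t in at_top. z t < K"
proof -
  \<comment> \<open>The second bound gives \<open>h t \<le> ln (x t)\<close>.\<close>
  have "\<forall>\<^sub>F u in at_top. f u \<le> q * (u / ln u) \<and> f u \<le> 1 * u"
    using q(2) eventually_f_le[of 1] by (auto simp: eventually_conj_iff)
  then obtain a where a: "\<And>u. u \<ge> a \<Longrightarrow> f u \<le> q * (u / ln u)" "\<And>u. u \<ge> a \<Longrightarrow> f u \<le> u"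
    by (auto simp: eventually_at_top_linorder)
  define b where "b = max a 2"
  define R where "R = G T\<^sub>0 - \<Phi> T\<^sub>0"
  have "K > 0" using K q(1) C_pos by (smt (verit) mult_pos_pos)
  have "K / q - C > 0" using K q(1) by (simp add: field_simps)
  hence "filterlim (\<lambda>u. (K / q - C) * ln u) at_top at_top" by real_asymp
  hence "\<forall>\<^sub>F u in at_top. (K / q - C) * ln u > R"
    by (simp add: filterlim_at_top_dense)
  hence "\<forall>\<^sub>F u in at_top. u \<ge> b \<and> (K / q - C) * ln u > R"
    using eventually_ge_at_top[of b] by (simp add: eventually_conj_iff)
  from eventually_x[OF this] eventually_ge_at_top[of "T\<^sub>0"]
  show ?thesis
  proof eventually_elim
    case (elim t)
    have t: "t > 0" using elim T0(1) \<tau>_pos by simp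
    have "ln (x t) > 0" using elim by (simp add: b_def)
    show ?case
    proof (rule ccontr)
      assume "\<not> z t < K"
      hence z: "z t \<ge> K" by simp
      hence "x t \<le> y t" using x_le_y_iff[of t] t \<open>K > 0\<close> by simp
      hence "(ln (y t))\<^sup>2 - (ln (x t))\<^sup>2 \<le> 2 * q * G t"
        using elim a q t ln_sq_diff_le_F_diff[of q b "x t" "y t"] by (simp add: G_eq b_def)
      moreover have "K * (2 * ln (x t)) \<le> z t * (z t + 2 * ln (x t))"
        using z \<open>K > 0\<close> \<open>ln (x t) > 0\<close> by (intro mult_mono) auto
      ultimately have "K * (2 * ln (x t)) \<le> 2 * q * G t" by (simp only: ln_sq_y)
      hence "K / q * ln (x t) \<le> G t" using q(1) by (simp add: field_simps)
      also have "\<dots> \<le> C * h t + R" unfolding R_def using elim by (intro G_le) auto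
      also have "h t \<le> ln (x t)"
        unfolding h_def using elim a(2)[of "x t"] fx_pos[of t] t \<tau>_pos by (simp add: b_def)
      finally have "K / q * ln (x t) \<le> C * ln (x t) + R" using C_pos by simp
      thus False using elim by (simp add: algebra_simps)
    qed
  qed
qed

text \<open>If \<open>z t \<le> K\<close>, then \<open>G t\<close> is at most
  \<open>K / p * ln (x t)\<close> plus a constant. But \<open>G_ge\<close> and the lower bound on
  \<open>f\<close> give nearly \<open>C * ln (x t)\<close>, with only a \<open>ln (ln (x t))\<close>
  loss, and \<open>K / p < C\<close>.\<close>

lemma z_lower:
  assumes p: "p > 0" "\<forall>\<^sub>F u in at_top. p * (u / ln u) \<le> f u" and K: "0 \<le> K" "K < p * C"
  shows "\<forall>\<^sub>F t in at_top. z t > K"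
proof -
  obtain a where a: "\<And>u. u \<ge> a \<Longrightarrow> p * (u / ln u) \<le> f u"
    using p(2) by (auto simp: eventually_at_top_linorder)
  define b where "b = max a 2"
  define k where "k = K / (p * C)"
  \<comment> \<open>Half of the relative slack is spent on \<open>G_ge\<close>; the other half
    remains as the coefficient \<open>c = e * C > 0\<close>.\<close>
  define e where "e = (1 - k) / 2"
  have "0 \<le> k" "k < 1" using K p C_pos by (auto simp: k_def)
  hence e: "0 < e" "e < 1" by (auto simp: e_def)
  define c where "c = (1 - e) * C - K / p"
  have "K / p = k * C" using p C_pos by (simp add: k_def)
  also have "\<dots> = (1 - 2 * e) * C" by (simp add: e_def field_simps)
  finally have "c = e * C" by (simp add: c_def algebra_simps)
  hence c: "c > 0" using e C_pos by simp
  obtain R where R: "\<forall>\<^sub>F t in at_top. (1 - e) * C * h t - R \<le> G t"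
    using G_ge[OF e] by blast
  define d where "d = (1 - e) * C"
  define r where "r = d * ln p - R - K\<^sup>2 / (2 * p)"
  have "filterlim (\<lambda>u. c * ln u - d * ln (ln u) + r) at_top at_top"
    using c by real_asymp
  hence "\<forall>\<^sub>F u in at_top. c * ln u - d * ln (ln u) + r > 0"
    by (simp add: filterlim_at_top_dense)
  hence "\<forall>\<^sub>F u in at_top. u \<ge> b \<and> c * ln u - d * ln (ln u) + r > 0"
    using eventually_ge_at_top[of b] by (simp add: eventually_conj_iff)
  from eventually_x[OF this] R eventually_ge_at_top[of "T\<^sub>0"]
    filterlim_at_top[THEN iffD1, OF y_at_top, rule_format, of b]
  show ?thesis
  proof eventually_elim
    case (elim t)
    have t: "t > 0" using elim T0(1) \<tau>_pos by simp
    have x: "x t > 1" "ln (x t) > 0" using elim by (auto simp: b_def)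
    have "ln p + ln (x t) - ln (ln (x t)) = ln (p * (x t / ln (x t)))"
      using p(1) x by (simp add: ln_mult ln_div)
    also have "\<dots> \<le> h t"
      unfolding h_def using a[of "x t"] elim x p(1) by (intro ln_mono) (auto simp: b_def)
    finally have "d * (ln p + ln (x t) - ln (ln (x t))) \<le> d * h t"
      using e C_pos by (simp add: d_def)
    hence "d * (ln p + ln (x t) - ln (ln (x t))) - R \<le> G t"
      using elim by (simp add: d_def)
    moreover have "d * (ln p + ln (x t) - ln (ln (x t))) - R
        = c * ln (x t) - d * ln (ln (x t)) + r + K\<^sup>2 / (2 * p) + K / p * ln (x t)"
      by (simp add: r_def c_def d_def algebra_simps)
    ultimately have G: "G t > K\<^sup>2 / (2 * p) + K / p * ln (x t)" using elim by linarith
    moreover have "K\<^sup>2 / (2 * p) + K / p * ln (x t) \<ge> 0" using K p x by simp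
    ultimately have "G t > 0" by linarith
    \<comment> \<open>The order of \<open>x t\<close> and \<open>y t\<close> is needed to integrate
      from one to the other, and \<open>z t \<ge> 0\<close> to bound the product below.\<close>
    hence "x t \<le> y t"
      using F_mono[of "y t" "x t"] y_pos[of t] t by (force simp: G_eq)
    hence "z t \<ge> 0" using x_le_y_iff t by simp
    show ?case
    proof (rule ccontr)
      assume "\<not> z t > K"
      hence z: "z t \<le> K" by simp
      have "2 * p * G t \<le> z t * (z t + 2 * ln (x t))"
        using F_diff_le_ln_sq_diff[of b p "x t" "y t"] elim a t \<open>x t \<le> y t\<close>
        by (simp add: G_eq b_def flip: ln_sq_y)
      also have "\<dots> \<le> K * (K + 2 * ln (x t))"
        using z \<open>z t \<ge> 0\<close> K x by (intro mult_mono) auto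
      finally have "G t \<le> K\<^sup>2 / (2 * p) + K / p * ln (x t)"
        using p(1) by (simp add: field_simps power2_eq_square)
      thus False using G by simp
    qed
  qed
qed

text \<open>If \<open>y t \<le> x t\<close>, then \<open>ln (x t) - ln (y t)\<close> is at most
  \<open>e\<close> times \<open>- G t\<close>, which is bounded above, and \<open>e\<close> may be
  arbitrarily small by sublinearity. This supplies the lower estimate for
  \<open>L = 0\<close>.\<close>

lemma z_gt_negative:
  assumes K: "K < 0"
  shows "\<forall>\<^sub>F t in at_top. z t > K"
proof -
  define R where "R = max 1 (- G T\<^sub>0)"
  \<comment> \<open>Makes \<open>e * R\<close> equal to \<open>- K / 2\<close>, strictly below
    \<open>- K\<close>.\<close>
  define e where "e = - K / (2 * R)"
  have "R > 0" by (simp add: R_def)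
  hence e: "e > 0" using K by (simp add: e_def divide_neg_pos)
  then obtain a where a: "\<And>u. u \<ge> a \<Longrightarrow> f u \<le> e * u"
    using eventually_f_le by (auto simp: eventually_at_top_linorder)
  define b where "b = max a 1"
  show ?thesis
    using eventually_ge_at_top[of "T\<^sub>0"] filterlim_at_top[THEN iffD1, OF y_at_top, rule_format, of b]
  proof eventually_elim
    case (elim t)
    have t: "t > 0" using elim T0(1) \<tau>_pos by simp
    show ?case
    proof (rule ccontr)
      assume "\<not> z t > K"
      hence z: "z t \<le> K" by simp
      hence "y t \<le> x t" using K x_le_y_iff[of t] t by auto
      hence "ln (x t) - ln (y t) \<le> e * (F (x t) - F (y t))"
        using a e elim by (intro ln_diff_le_F_diff[of e b]) (auto simp: b_def)
      also have "\<dots> \<le> e * R"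
        using e G_mono[of "T\<^sub>0" t] elim t by (intro mult_left_mono) (auto simp: R_def G_eq)
      also have "\<dots> = - K / 2" using \<open>R > 0\<close> by (simp add: e_def)
      finally show False using z K by (simp add: z_def)
    qed
  qed
qed

lemma ratio_tendsto:
  assumes L: "0 \<le> L" "((\<lambda>u. ereal (f u / (u / ln u))) \<longlongrightarrow> L) at_top"
  shows "((\<lambda>t. x t / y t) \<longlongrightarrow> exp_neg (L * ereal C)) at_top"
proof -
  have lower: "\<forall>\<^sub>F t in at_top. z t > K" if p: "p > 0" "ereal p < L" and K: "K < p * C" for K p
  proof -
    have "\<forall>\<^sub>F u in at_top. p * (u / ln u) \<le> f u"
      using order_tendstoD(1)[OF L(2) p(2)] eventually_gt_at_top[of 1]
      by eventually_elim (simp add: field_simps)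
    \<comment> \<open>\<open>z_lower\<close> needs a nonnegative threshold, and
      \<open>p * C > 0\<close> leaves room for 0.\<close>
    hence "\<forall>\<^sub>F t in at_top. z t > max 0 K"
      by (rule z_lower[OF p(1)]) (use K p C_pos in auto)
    thus ?thesis by eventually_elim simp
  qed
  have eq: "\<forall>\<^sub>F t in at_top. exp (- z t) = x t / y t"
    using eventually_ge_at_top[of 0]
    by eventually_elim (use x_pos y_pos \<tau>_pos in \<open>simp add: z_def exp_diff\<close>)
  show ?thesis
  proof (cases L)
    case PInf
    have "filterlim z at_top at_top"
      unfolding filterlim_at_top_dense
    proof
      fix K :: real
      show "\<forall>\<^sub>F t in at_top. K < z t"
      proof (rule lower)
        \<comment> \<open>Every real \<open>p\<close> lies below \<open>L\<close> here;
          \<open>p = \<bar>K\<bar> / C + 1\<close> gives \<open>p * C > K\<close>.\<close>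
        have "\<bar>K\<bar> / C \<ge> 0" using C_pos by simp
        thus "\<bar>K\<bar> / C + 1 > 0" by linarith
        have "(\<bar>K\<bar> / C + 1) * C = \<bar>K\<bar> + C" using C_pos by (simp add: field_simps)
        thus "K < (\<bar>K\<bar> / C + 1) * C" using C_pos by linarith
      qed (use PInf in simp)
    qed
    hence "((\<lambda>t. exp (- z t)) \<longlongrightarrow> 0) at_top"
      by (intro filterlim_compose[OF exp_at_bot]) (simp add: filterlim_uminus_at_bot)
    thus ?thesis using PInf C_pos eq by (simp add: exp_neg_def filterlim_cong)
  next
    case (real l)
    have "(z \<longlongrightarrow> l * C) at_top"
    proof (rule order_tendstoI)
      fix K assume K: "K < l * C"
      show "\<forall>\<^sub>F t in at_top. K < z t"
      proof (cases "l = 0")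
        case True
        thus ?thesis using K z_gt_negative by simp
      next
        case False
        \<comment> \<open>The midpoint \<open>p\<close> of \<open>m\<close> and \<open>l\<close> is
          positive even for negative \<open>K\<close>, and satisfies
          \<open>K < p * C\<close>.\<close>
        define m where "m = max 0 (K / C)"
        define p where "p = (m + l) / 2"
        have "0 \<le> m" "K / C \<le> m" by (auto simp: m_def)
        have "m < l" unfolding m_def using False L(1) real K C_pos by (simp add: field_simps)
        hence p: "m < p" "p < l" "p > 0" using \<open>0 \<le> m\<close> by (auto simp: p_def)
        have "K / C < p" using \<open>K / C \<le> m\<close> p(1) by (rule order_le_less_trans)
        with C_pos have "K < p * C" by (simp only: pos_divide_less_eq)
        thus ?thesis using p real by (intro lower[of p]) auto
      qed
    next
      fix K assume K: "K > l * C"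
      define k where "k = K / C"
      \<comment> \<open>Lying strictly between \<open>l\<close> and \<open>K / C\<close>,
        \<open>q\<close> bounds \<open>f\<close> eventually and satisfies
        \<open>q * C < K\<close>.\<close>
      define q where "q = (k + l) / 2"
      have "l \<ge> 0" using L(1) real by simp
      have "l < k" using K C_pos by (simp add: k_def field_simps)
      hence q: "q > 0" "l < q" "q < k" using \<open>l \<ge> 0\<close> by (auto simp: q_def)
      hence "L < ereal q" using real by simp
      have "\<forall>\<^sub>F u in at_top. f u \<le> q * (u / ln u)"
        using order_tendstoD(2)[OF L(2) \<open>L < ereal q\<close>] eventually_gt_at_top[of 1]
        by eventually_elim (simp add: field_simps)
      thus "\<forall>\<^sub>F t in at_top. z t < K"
        using q C_pos by (intro z_upper[of q]) (auto simp: k_def field_simps)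
    qed
    hence "((\<lambda>t. exp (- z t)) \<longlongrightarrow> exp (- (l * C))) at_top"
      by (intro tendsto_intros)
    thus ?thesis using real eq by (simp add: exp_neg_def filterlim_cong)
  qed (use L(1) in simp)
qed

end

section \<open>Transfer to solutions of the delay equation\<close>

theorem theorem1:
  fixes f \<psi> x :: "real \<Rightarrow> real"
    and x\<^sub>1 \<tau> M C :: real
    and L :: ereal
    and \<mu> :: "real measure"
  assumes f_C1: "f C1_differentiable_on {0<..}"
    and f_pos: "\<And>y. y > 0 \<Longrightarrow> f y > 0"
    and x1_nonneg: "x\<^sub>1 \<ge> 0"
    and f'_pos: "\<And>y. y > x\<^sub>1 \<Longrightarrow> deriv f y > 0"
    and f'_lim: "(deriv f \<longlongrightarrow> 0) at_top"
    and L_nonneg: "0 \<le> L"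
    and L_lim: "((\<lambda>y. ereal (f y / (y / ln y))) \<longlongrightarrow> L) at_top"
    and \<tau>_pos: "\<tau> > 0"
    and \<mu>_sets: "sets \<mu> = sets (restrict_space borel {-\<tau>..0})"
    and \<mu>_finite: "finite_measure \<mu>"
    and M_eq: "M = (\<integral>s. 1 \<partial>\<mu>)"
    and M_pos: "M > 0"
    and C_eq: "C = (\<integral>s. \<bar>s\<bar> \<partial>\<mu>)"
    and C_pos: "C > 0"
    and \<psi>_cont: "continuous_on {-\<tau>..0} \<psi>"
    and \<psi>_pos: "\<And>t. t \<in> {-\<tau>..0} \<Longrightarrow> \<psi> t > 0"
    and x_sol: "delay_solution f \<mu> \<tau> \<psi> x"
  shows "filterlim x at_top at_top
    \<and> ((\<lambda>t. F_of f (x t) / t) \<longlongrightarrow> M) at_top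
    \<and> ((\<lambda>t. x t / F_inv f (M * t)) \<longlongrightarrow> exp_neg (L * ereal C)) at_top"
proof -
  \<comment> \<open>The derivative provided by C1 differentiability is identified with
    \<open>deriv f\<close>, in which the other hypotheses are phrased.\<close>
  obtain D where D: "\<And>u. u > 0 \<Longrightarrow> (f has_vector_derivative D u) (at u)"
    using f_C1 unfolding C1_differentiable_on_def by auto
  have f_deriv: "(f has_real_derivative deriv f u) (at u)" if "u > 0" for u
    using D[OF that] DERIV_imp_deriv by (metis has_real_derivative_iff_has_vector_derivative)
  interpret delay_growth \<mu> f "deriv f" x x\<^sub>1 \<tau> M C
  proof (intro delay_growth.intro delay_growth_axioms.intro)
    show "(x has_real_derivative (\<integral>s. f (x (t + s)) \<partial>\<mu>)) (at t)" if "t > 0" for t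
      using x_sol that by (simp add: delay_solution_def)
  qed (use assms f_deriv x_sol in \<open>simp_all add: delay_solution_def\<close>)
  show ?thesis
    using x_at_top F_over_t ratio_tendsto[OF L_nonneg L_lim] by (simp add: y_def)
qed

end
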